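(* There is an absolute constant $C>0$ such that the following holds. Suppose each unit cell $[i,i+1)\times[j,j+1)$, $i,j\in\mathbb{Z}$, of the plane $\mathbb{R}^2$ is painted black or white, in an arbitrary manner. Then there exist arbitrarily long line segments $I$ (that is, for every $L>0$ there is a line segment $I\subset\mathbb{R}^2$ with $|I|\ge L$) such that $$\bigl|\,b(I)-w(I)\,\bigr|\ \ge\ C\sqrt{|I|},$$ where $b(I)$ and $w(I)$ are the lengths of the black part and of the white part of $I$, respectively.
   Context: $|I|$ denotes the length of the line segment $I$, and the length of the black (resp. white) part of $I$ is the one-dimensional Lebesgue measure (arc length) of the set of points of $I$ lying in black (resp. white) cells. The constant $C$ is absolute: it does not depend on the coloring or on the segment. *)

theory Defs
  imports "HOL-Analysis.Analysis"
begin

datatype colour = Black | White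

definition cell :: "int \<Rightarrow> int \<Rightarrow> (real \<times> real) set" where
  "cell i j = {of_int i ..< of_int i + 1} \<times> {of_int j ..< of_int j + 1}"

definition coloured_region :: "(int \<Rightarrow> int \<Rightarrow> colour) \<Rightarrow> colour \<Rightarrow> (real \<times> real) set" where
  "coloured_region f c = \<Union> {cell i j | i j. f i j = c}"

(* Arc length of the part of the segment from a to b that lies in S: the Lebesgue measure of the
   preimage of S under the unit-speed parametrization (sgn v = v / norm v, and sgn 0 = 0).
   The norm on real * real is the Euclidean one. *)
definition segment_length_in :: "real \<times> real \<Rightarrow> real \<times> real \<Rightarrow> (real \<times> real) set \<Rightarrow> real" where
  "segment_length_in a b S = measure lebesgue {s \<in> {0..dist a b}. a + s *\<^sub>R sgn (b - a) \<in> S}"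

definition black_length :: "(int \<Rightarrow> int \<Rightarrow> colour) \<Rightarrow> real \<times> real \<Rightarrow> real \<times> real \<Rightarrow> real" where
  "black_length f a b = segment_length_in a b (coloured_region f Black)"

definition white_length :: "(int \<Rightarrow> int \<Rightarrow> colour) \<Rightarrow> real \<times> real \<Rightarrow> real \<times> real \<Rightarrow> real" where
  "white_length f a b = segment_length_in a b (coloured_region f White)"

end

theory Submission
  imports Defs
begin

text \<open>Cut the $\pm 1$ colouring off outside the box $[0,n]^2$ and call the result $g$. The claim reduces
  to finding a line over which $g$ has an integral of size at least a constant times $\sqrt n$: its
  intersection with the box is a segment on which black and white differ by that much. The segment
  is then long, since the difference is at most its length, and its length is at most $2n$, so
  that $\sqrt n$ may be replaced by the square root of the length.

  Suppose all line integrals are at most $M$. For each slope $m$ consider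
  $\int\!\int g(p)\, g(q)\, \kappa_m(\ell_m(p) - \ell_m(q))\, dp\, dq$ with $\ell_m(x,y) = y - mx$. Integrating
  along the lines of slope $m$ first bounds it in terms of $M^2 n \|\kappa_m\|_1$
  (\<open>energy_of_slope_le\<close>), and the integral over all $m$ is $O(n M^2)$ (\<open>energy_le\<close>). On the other
  hand, integrating over $m$ first replaces $\kappa_m(v - mu)$ by a kernel in the plane. As in filtered
  backprojection for the X-ray transform, $\kappa_m$ can be chosen so that this kernel is a positive
  approximate identity; here it is a product of two Cauchy kernels of a small constant width
  (\<open>integral_ramp_kernel_slope\<close>). Most of its mass stays within the cell of $p$, where
  $g(p)\, g(q) = 1$, so the double integral is at least a constant times $n^2$ (\<open>energy_ge\<close>). Comparing the
  two bounds gives $M^2 \ge c\, n$.\<close>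

section \<open>Ramp kernels and the Cauchy kernel\<close>

text \<open>With $s = e\,(1 + |m|)$ this is the real part of $(s + it)^{-2}$, that is, half the Fourier
  transform of $|\eta|\, e^{-s|\eta|}$. The factor $|\eta|$ is the ramp filter that inverts the
  averaging over lines. The rate $e\,(|\eta| + |m\eta|)$ is chosen because
  $(-m\eta, \eta)$ is the plane frequency seen by lines of slope $m$: it makes the superposition
  over all slopes the transform of $e^{-e|\xi|}\, e^{-e|\eta|}$, a product kernel.\<close>

definition ramp_kernel :: "real \<Rightarrow> real \<Rightarrow> real \<Rightarrow> real" where
  "ramp_kernel e m t =
     ((e * (1 + \<bar>m\<bar>))\<^sup>2 - t\<^sup>2) / ((e * (1 + \<bar>m\<bar>))\<^sup>2 + t\<^sup>2)\<^sup>2"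

text \<open>The Poisson kernel of the half plane at height $e$, without the factor $1/\pi$: its mass is $\pi$.\<close>

definition cauchy_kernel :: "real \<Rightarrow> real \<Rightarrow> real" where
  "cauchy_kernel e u = e / (e\<^sup>2 + u\<^sup>2)"

lemma half_line_FTC_nonneg:
  fixes f F :: "real \<Rightarrow> real"
  assumes "f \<in> borel_measurable borel"
    and "\<And>x. 0 \<le> x \<Longrightarrow> (F has_real_derivative f x) (at x)"
    and "\<And>x. 0 \<le> x \<Longrightarrow> 0 \<le> f x"
    and "(F \<longlongrightarrow> T) at_top"
  shows "has_bochner_integral lborel (\<lambda>x. indicator {0..} x *\<^sub>R f x) (T - F 0)"
proof -
  have mono: "F 0 \<le> F x" if "0 \<le> x" for x
    using assms(2,3) that by (intro DERIV_nonneg_imp_nondecreasing[of 0 x F]) (auto intro: order_trans)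
  have "F 0 \<le> T"
    by (rule tendsto_lowerbound[OF assms(4)]) (auto simp: eventually_at_top_linorder intro!: mono)
  moreover have "(\<integral>\<^sup>+x. ennreal (indicator {0..} x *\<^sub>R f x) \<partial>lborel) = ennreal (T - F 0)"
  proof -
    have "(\<integral>\<^sup>+x. ennreal (indicator {0..} x *\<^sub>R f x) \<partial>lborel)
        = (\<integral>\<^sup>+x. ennreal (f x) * indicator {0..} x \<partial>lborel)"
      by (intro nn_integral_cong) (auto simp: indicator_def)
    then show ?thesis
      using nn_integral_FTC_atLeast[of f 0 F T] assms by simp
  qed
  ultimately show ?thesis
    using assms(1,3) by (intro has_bochner_integral_nn_integral) (auto simp: indicator_def)
qed

lemma has_bochner_integral_cauchy:
  assumes "e > 0"
  shows "has_bochner_integral lborel (cauchy_kernel e) pi"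
proof -
  have "has_bochner_integral lborel (\<lambda>x. indicator {0..} x *\<^sub>R cauchy_kernel e x) (pi/2 - arctan (0/e))"
  proof (rule half_line_FTC_nonneg)
    show "cauchy_kernel e \<in> borel_measurable borel" unfolding cauchy_kernel_def by measurable
    show "((\<lambda>x. arctan (x/e)) has_real_derivative cauchy_kernel e x) (at x)" for x
      using assms unfolding cauchy_kernel_def
      by (auto intro!: derivative_eq_intros simp: field_simps power2_eq_square)
    show "0 \<le> cauchy_kernel e x" for x using assms by (simp add: cauchy_kernel_def)
    show "((\<lambda>x. arctan (x/e)) \<longlongrightarrow> pi/2) at_top"
    proof (rule filterlim_compose[OF tendsto_arctan_at_top])
      show "LIM x at_top. x / e :> at_top"
        using filterlim_tendsto_pos_mult_at_top[OF tendsto_const _ filterlim_ident, of "1/e"] assms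
        by simp
    qed
  qed
  from has_bochner_integral_even_function[OF this] show ?thesis by (simp add: cauchy_kernel_def[abs_def])
qed

lemma has_bochner_integral_inverse_square:
  "has_bochner_integral lborel (\<lambda>x::real. 1 / (1 + \<bar>x\<bar>)\<^sup>2) 2"
proof -
  have "has_bochner_integral lborel (\<lambda>x::real. indicator {0..} x *\<^sub>R (1 / (1 + x)\<^sup>2)) (0 - (- 1 / (1 + 0)))"
  proof (rule half_line_FTC_nonneg)
    show "((\<lambda>x. - 1 / (1 + x)) has_real_derivative 1 / (1 + x)\<^sup>2) (at x)" if "0 \<le> x" for x :: real
      using that by (auto intro!: derivative_eq_intros simp: field_simps power2_eq_square)
    show "((\<lambda>x. - 1 / (1 + x)) \<longlongrightarrow> (0::real)) at_top"
      by (intro tendsto_divide_0[OF tendsto_const] filterlim_at_top_imp_at_infinity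
            filterlim_tendsto_add_at_top[OF tendsto_const filterlim_ident])
  qed auto
  moreover have "(\<lambda>x::real. indicator {0..} x *\<^sub>R (1 / (1 + x)\<^sup>2)) = (\<lambda>x. indicator {0..} x *\<^sub>R (1 / (1 + \<bar>x\<bar>)\<^sup>2))"
    by (auto simp: indicator_def)
  ultimately have "has_bochner_integral lborel (\<lambda>x::real. indicator {0..} x *\<^sub>R (1 / (1 + \<bar>x\<bar>)\<^sup>2)) 1"
    by simp
  from has_bochner_integral_even_function[OF this] show ?thesis by simp
qed

text \<open>A version for integrands that change sign, as the ramp kernel does; integrability then has to be known beforehand.\<close>

lemma half_line_FTC_integrable:
  fixes f F :: "real \<Rightarrow> real"
  assumes int: "integrable lborel f"
    and F: "\<And>x. 0 \<le> x \<Longrightarrow> (F has_real_derivative f x) (at x)"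
    and cont: "continuous_on {0..} f"
    and lim: "(F \<longlongrightarrow> T) at_top"
  shows "(\<integral>x. indicator {0..} x * f x \<partial>lborel) = T - F 0"
proof -
  have "((\<lambda>b. set_lebesgue_integral lborel {0..b} f) \<longlongrightarrow> set_lebesgue_integral lborel {0..} f) at_top"
    by (rule tendsto_set_lebesgue_integral_at_top)
       (use integrable_mult_indicator[OF _ int, of "{0..}"] in \<open>auto simp: set_integrable_def\<close>)
  moreover have "\<forall>\<^sub>F b in at_top. set_lebesgue_integral lborel {0..b} f = F b - F 0"
    using eventually_ge_at_top[of 0]
  proof eventually_elim
    fix b :: real assume b: "0 \<le> b"
    show "set_lebesgue_integral lborel {0..b} f = F b - F 0"
      unfolding set_lebesgue_integral_def
    proof (rule integral_FTC_atLeastAtMost[OF b])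
      show "(F has_vector_derivative f x) (at x within {0..b})" if "0 \<le> x" for x
        using F[OF that] by (simp add: has_real_derivative_iff_has_vector_derivative has_vector_derivative_at_within)
      show "continuous_on {0..b} f" by (rule continuous_on_subset[OF cont]) auto
    qed
  qed
  ultimately have "((\<lambda>b. F b - F 0) \<longlongrightarrow> set_lebesgue_integral lborel {0..} f) at_top"
    by (rule Lim_transform_eventually)
  moreover have "((\<lambda>b. F b - F 0) \<longlongrightarrow> T - F 0) at_top" by (intro tendsto_intros lim)
  ultimately have "set_lebesgue_integral lborel {0..} f = T - F 0"
    by (rule tendsto_unique[OF trivial_limit_at_top_linorder])
  then show ?thesis
    by (simp add: set_lebesgue_integral_def)
qed

lemma ramp_kernel_measurable [measurable]:
  assumes [measurable]: "f \<in> borel_measurable M" "g \<in> borel_measurable M"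
  shows "(\<lambda>x. ramp_kernel e (f x) (g x)) \<in> borel_measurable M"
  unfolding ramp_kernel_def by measurable

lemma cauchy_measurable [measurable]: "cauchy_kernel e \<in> borel_measurable borel"
  unfolding cauchy_kernel_def by measurable

lemma abs_ramp_kernel_le:
  assumes "e > 0"
  shows "\<bar>ramp_kernel e m t\<bar> \<le> cauchy_kernel (e * (1 + \<bar>m\<bar>)) t / (e * (1 + \<bar>m\<bar>))"
proof -
  define s where "s = e * (1 + \<bar>m\<bar>)"
  have s: "s > 0" using assms by (auto simp: s_def intro!: mult_pos_pos)
  have D: "s\<^sup>2 + t\<^sup>2 > 0" using s by (simp add: add_pos_nonneg)
  have "\<bar>ramp_kernel e m t\<bar> = \<bar>s\<^sup>2 - t\<^sup>2\<bar> / (s\<^sup>2 + t\<^sup>2)\<^sup>2"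
    by (simp add: ramp_kernel_def s_def abs_divide)
  also have "\<dots> \<le> (s\<^sup>2 + t\<^sup>2) / (s\<^sup>2 + t\<^sup>2)\<^sup>2"
    by (intro divide_right_mono) (auto simp: abs_if)
  also have "\<dots> = cauchy_kernel s t / s" using s D by (simp add: cauchy_kernel_def power2_eq_square)
  finally show ?thesis by (simp add: s_def)
qed

lemma abs_ramp_kernel_le_inverse_square:
  assumes "e > 0"
  shows "\<bar>ramp_kernel e m t\<bar> \<le> 1 / e\<^sup>2 * (1 / (1 + \<bar>m\<bar>)\<^sup>2)"
proof -
  define s where "s = e * (1 + \<bar>m\<bar>)"
  have s: "s > 0" using assms by (auto simp: s_def intro!: mult_pos_pos)
  have "\<bar>ramp_kernel e m t\<bar> \<le> cauchy_kernel s t / s"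
    using abs_ramp_kernel_le[OF assms] by (simp add: s_def)
  also have "\<dots> = 1 / (s\<^sup>2 + t\<^sup>2)" using s by (simp add: cauchy_kernel_def)
  also have "\<dots> \<le> 1 / s\<^sup>2" using s by (intro divide_left_mono) (auto intro!: mult_pos_pos add_pos_nonneg)
  finally show ?thesis by (simp add: s_def power_mult_distrib)
qed

lemma integrable_ramp_kernel:
  assumes "e > 0"
  shows "integrable lborel (ramp_kernel e m)"
    and "(\<integral>t. \<bar>ramp_kernel e m t\<bar> \<partial>lborel) \<le> pi / (e * (1 + \<bar>m\<bar>))"
proof -
  define s where "s = e * (1 + \<bar>m\<bar>)"
  have s: "s > 0" using assms by (auto simp: s_def intro!: mult_pos_pos)
  have c: "has_bochner_integral lborel (\<lambda>t. cauchy_kernel s t / s) (pi / s)"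
    using has_bochner_integral_cauchy[OF s] by (rule has_bochner_integral_divide_zero)
  have b: "\<bar>ramp_kernel e m t\<bar> \<le> cauchy_kernel s t / s" for t
    using abs_ramp_kernel_le[OF assms] by (simp add: s_def)
  show i: "integrable lborel (ramp_kernel e m)"
    by (rule Bochner_Integration.integrable_bound[OF integrable.intros[OF c]])
       (use b in \<open>auto intro!: AE_I2 order_trans[OF b abs_ge_self] simp del: abs_divide\<close>)
  have "(\<integral>t. \<bar>ramp_kernel e m t\<bar> \<partial>lborel) \<le> (\<integral>t. cauchy_kernel s t / s \<partial>lborel)"
    by (rule integral_mono) (use i b c in \<open>auto simp: has_bochner_integral_iff\<close>)
  then show "(\<integral>t. \<bar>ramp_kernel e m t\<bar> \<partial>lborel) \<le> pi / (e * (1 + \<bar>m\<bar>))"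
    unfolding has_bochner_integral_integral_eq[OF c] by (simp add: s_def)
qed

lemma integrable_ramp_kernel_slope:
  assumes "e > 0"
  shows "integrable lborel (\<lambda>m. ramp_kernel e m (v - m * u))"
proof (rule Bochner_Integration.integrable_bound)
  show "integrable lborel (\<lambda>m. 1 / e\<^sup>2 * (1 / (1 + \<bar>m\<bar>)\<^sup>2))"
    using has_bochner_integral_inverse_square by (intro integrable_mult_right) (simp add: has_bochner_integral_iff)
  show "AE m in lborel. norm (ramp_kernel e m (v - m * u)) \<le> norm (1 / e\<^sup>2 * (1 / (1 + \<bar>m\<bar>)\<^sup>2))"
    by (rule AE_I2) (use abs_ramp_kernel_le_inverse_square[OF assms] in \<open>auto intro: order_trans\<close>)
qed measurable

text \<open>Put $A = e + iv$ and $B = e - iu$. For $m \ge 0$ the integrand is the real part of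
  $(A + mB)^{-2}$, with antiderivative $-1/(B(A + mB))$, so the value is $\mathrm{Re}\,1/(AB)$.
  The function \<open>G\<close> of the proof is the real part of that antiderivative.\<close>

lemma half_line_ramp_kernel:
  assumes e: "e > 0"
  shows "(\<integral>m. indicator {0..} m * ramp_kernel e m (v - m * u) \<partial>lborel)
           = (e\<^sup>2 + u * v) / ((e\<^sup>2 + u\<^sup>2) * (e\<^sup>2 + v\<^sup>2))"
proof -
  define G where "G m = - ((e\<^sup>2 + u * v) + m * (e\<^sup>2 - u\<^sup>2)) /
     ((e\<^sup>2 + u\<^sup>2) * ((e * (1 + m))\<^sup>2 + (v - m*u)\<^sup>2))" for m
  have pos: "e\<^sup>2 + u\<^sup>2 > 0" using e by (simp add: add_pos_nonneg)
  have D: "(e * (1 + m))\<^sup>2 + (v - m*u)\<^sup>2 > 0" if "m \<ge> 0" for m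
    using e that by (intro add_pos_nonneg) auto
  have eq: "ramp_kernel e m (v - m*u) = ((e*(1+m))\<^sup>2 - (v-m*u)\<^sup>2) / ((e*(1+m))\<^sup>2 + (v-m*u)\<^sup>2)\<^sup>2"
    if "m \<ge> 0" for m using that by (simp add: ramp_kernel_def)
  have "(\<integral>m. indicator {0..} m * ramp_kernel e m (v - m * u) \<partial>lborel) = 0 - G 0"
  proof (rule half_line_FTC_integrable[OF integrable_ramp_kernel_slope[OF e]])
    show "continuous_on {0..} (\<lambda>m. ramp_kernel e m (v - m * u))"
    proof (rule continuous_on_eq)
      show "continuous_on {0..} (\<lambda>m. ((e*(1+m))\<^sup>2 - (v-m*u)\<^sup>2) / ((e*(1+m))\<^sup>2 + (v-m*u)\<^sup>2)\<^sup>2)"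
        using D by (intro continuous_intros) (auto dest: D)
    qed (simp add: eq)
    show "(G has_real_derivative ramp_kernel e m (v - m * u)) (at m)" if m: "0 \<le> m" for m
    proof -
      define D0 where "D0 = (e * (1 + m))\<^sup>2 + (v - m*u)\<^sup>2"
      have D0: "D0 > 0" using D[OF m] by (simp add: D0_def)
      have N': "((\<lambda>m. - ((e\<^sup>2 + u * v) + m * (e\<^sup>2 - u\<^sup>2))) has_real_derivative - (e\<^sup>2 - u\<^sup>2)) (at m)"
        by (auto intro!: derivative_eq_intros)
      have D': "((\<lambda>m. (e\<^sup>2 + u\<^sup>2) * ((e * (1 + m))\<^sup>2 + (v - m * u)\<^sup>2)) has_real_derivative
          (e\<^sup>2 + u\<^sup>2) * (2 * (e * (1 + m)) * e - 2 * (v - m * u) * u)) (at m)"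
        by (rule DERIV_cmult) (auto intro!: derivative_eq_intros)
      have "(e\<^sup>2 + u\<^sup>2) * ((e * (1 + m))\<^sup>2 + (v - m * u)\<^sup>2) \<noteq> 0"
        by (rule less_imp_neq[OF mult_pos_pos[OF pos D[OF m]], symmetric])
      note DERIV_divide[OF N' D' this]
      also have "- (e\<^sup>2 - u\<^sup>2) * ((e\<^sup>2 + u\<^sup>2) * ((e * (1 + m))\<^sup>2 + (v - m * u)\<^sup>2))
            - - ((e\<^sup>2 + u * v) + m * (e\<^sup>2 - u\<^sup>2)) *
                ((e\<^sup>2 + u\<^sup>2) * (2 * (e * (1 + m)) * e - 2 * (v - m * u) * u))
          = (e\<^sup>2 + u\<^sup>2)\<^sup>2 * ((e * (1 + m))\<^sup>2 - (v - m * u)\<^sup>2)"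
        by algebra
      finally have "(G has_real_derivative (e\<^sup>2 + u\<^sup>2)\<^sup>2 * ((e * (1 + m))\<^sup>2 - (v - m * u)\<^sup>2)
          / ((e\<^sup>2 + u\<^sup>2) * D0 * ((e\<^sup>2 + u\<^sup>2) * D0))) (at m)"
        unfolding G_def D0_def .
      also have "(e\<^sup>2 + u\<^sup>2)\<^sup>2 * ((e * (1 + m))\<^sup>2 - (v - m * u)\<^sup>2)
          / ((e\<^sup>2 + u\<^sup>2) * D0 * ((e\<^sup>2 + u\<^sup>2) * D0))
        = ((e * (1 + m))\<^sup>2 - (v - m * u)\<^sup>2) / D0\<^sup>2"
        using pos D0 e by (simp add: power2_eq_square[of D0] power2_eq_square[of "e\<^sup>2 + u\<^sup>2"])
      also have "\<dots> = ramp_kernel e m (v - m * u)"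
        using m by (simp add: eq D0_def)
      finally show ?thesis .
    qed
    show "(G \<longlongrightarrow> 0) at_top"
    proof (rule Lim_null_comparison)
      define K where "K = \<bar>e\<^sup>2 + u * v\<bar> + \<bar>e\<^sup>2 - u\<^sup>2\<bar>"
      show "\<forall>\<^sub>F m in at_top. norm (G m) \<le> (K / ((e\<^sup>2 + u\<^sup>2) * e\<^sup>2)) * (1 / (1 + m))"
        using eventually_ge_at_top[of 0]
      proof eventually_elim
        fix m :: real assume m: "0 \<le> m"
        have "\<bar>(e\<^sup>2 + u * v) + m * (e\<^sup>2 - u\<^sup>2)\<bar> \<le> \<bar>e\<^sup>2 + u * v\<bar> + m * \<bar>e\<^sup>2 - u\<^sup>2\<bar>"
          using m by (intro order_trans[OF abs_triangle_ineq]) (simp add: abs_mult)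
        also have "\<dots> \<le> K * (1 + m)"
          using m by (simp add: K_def algebra_simps)
        finally have num: "\<bar>(e\<^sup>2 + u * v) + m * (e\<^sup>2 - u\<^sup>2)\<bar> \<le> K * (1 + m)" .
        have "norm (G m) = \<bar>(e\<^sup>2 + u * v) + m * (e\<^sup>2 - u\<^sup>2)\<bar> / ((e\<^sup>2 + u\<^sup>2) * ((e * (1 + m))\<^sup>2 + (v - m*u)\<^sup>2))"
          using pos D[OF m] by (simp add: G_def abs_divide abs_mult del: minus_add_distrib)
        also have "\<dots> \<le> K * (1 + m) / ((e\<^sup>2 + u\<^sup>2) * (e * (1 + m))\<^sup>2)"
          using num pos m e by (intro frac_le mult_left_mono) (auto intro!: mult_pos_pos)
        also have "\<dots> = (K / ((e\<^sup>2 + u\<^sup>2) * e\<^sup>2)) * (1 / (1 + m))"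
          using m pos e by (simp add: power2_eq_square)
        finally show "norm (G m) \<le> (K / ((e\<^sup>2 + u\<^sup>2) * e\<^sup>2)) * (1 / (1 + m))" .
      qed
      show "((\<lambda>m. K / ((e\<^sup>2 + u\<^sup>2) * e\<^sup>2) * (1 / (1 + m))) \<longlongrightarrow> 0) at_top"
        by (intro tendsto_mult_right_zero tendsto_divide_0[OF tendsto_const] filterlim_at_top_imp_at_infinity
            filterlim_tendsto_add_at_top[OF tendsto_const filterlim_ident])
    qed
  qed
  then show ?thesis by (simp add: G_def minus_divide_left)
qed

text \<open>Negative slopes contribute the half-line integral with $u$ replaced by $-u$; in the sum the
  mixed terms $\pm uv$ cancel and a positive product kernel remains. This positivity is what the
  lower bound for the energy rests on.\<close>

lemma integral_ramp_kernel_slope: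
  assumes e: "e > 0"
  shows "(\<integral>m. ramp_kernel e m (v - m * u) \<partial>lborel) = 2 * cauchy_kernel e u * cauchy_kernel e v"
proof -
  let ?f = "\<lambda>u m. ramp_kernel e m (v - m * u)"
  have i: "integrable lborel (\<lambda>m. indicator A m * ?f u m)" if "A \<in> sets lborel" for A u
    using integrable_mult_indicator[OF that integrable_ramp_kernel_slope[OF e, of v u]] by simp
  have "(\<integral>m. ?f u m \<partial>lborel) = (\<integral>m. indicator {0..} m * ?f u m + indicator {..0} m * ?f u m \<partial>lborel)"
  proof (rule integral_cong_AE)
    show "AE m in lborel. ?f u m = indicator {0..} m * ?f u m + indicator {..0} m * ?f u m"
      using AE_lborel_singleton[of "0::real"] by eventually_elim (auto simp: indicator_def)
  qed auto
  also have "\<dots> = (\<integral>m. indicator {0..} m * ?f u m \<partial>lborel) + (\<integral>m. indicator {..0} m * ?f u m \<partial>lborel)"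
    by (intro Bochner_Integration.integral_add i) auto
  also have "(\<integral>m. indicator {..0} m * ?f u m \<partial>lborel) = (\<integral>m. indicator {0..} m * ?f (-u) m \<partial>lborel)"
    by (subst lborel_integral_real_affine[where c="-1" and t=0])
       (auto simp: indicator_def ramp_kernel_def intro!: Bochner_Integration.integral_cong)
  also have "(\<integral>m. indicator {0..} m * ?f u m \<partial>lborel) + \<dots> = 2 * cauchy_kernel e u * cauchy_kernel e v"
    unfolding half_line_ramp_kernel[OF e] cauchy_kernel_def
    by (simp add: add_divide_distrib [symmetric] power2_eq_square)
  finally show ?thesis .
qed

section \<open>Integration over the plane\<close>

lemma borel_measurable_fst [measurable]:
  "(fst :: 'a::topological_space \<times> 'b::topological_space \<Rightarrow> 'a) \<in> borel_measurable borel"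
  by (intro borel_measurable_continuous_onI continuous_intros)

lemma borel_measurable_snd [measurable]:
  "(snd :: 'a::topological_space \<times> 'b::topological_space \<Rightarrow> 'b) \<in> borel_measurable borel"
  by (intro borel_measurable_continuous_onI continuous_intros)

lemma integrable_bounded_on_cbox:
  fixes k :: "'a::euclidean_space \<Rightarrow> real"
  assumes "k \<in> borel_measurable borel" "\<And>x. \<bar>k x\<bar> \<le> B" "\<And>x. x \<notin> cbox a b \<Longrightarrow> k x = 0"
  shows "integrable lborel k"
proof (rule Bochner_Integration.integrable_bound)
  show "integrable lborel (\<lambda>x. B * indicator (cbox a b) x)"
    by (intro integrable_mult_right integrable_real_indicator) (auto simp: emeasure_lborel_cbox_eq)
  show "AE x in lborel. norm (k x) \<le> norm (B * indicator (cbox a b) x)"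
  proof (rule AE_I2)
    fix x show "norm (k x) \<le> norm (B * indicator (cbox a b) x)"
      using assms(2)[of x] assms(3)[of x] by (cases "x \<in> cbox a b") (auto simp: abs_if)
  qed
qed (use assms(1) in simp)

lemma integrable_tensor:
  fixes f :: "'a::euclidean_space \<Rightarrow> real" and g :: "'b::euclidean_space \<Rightarrow> real"
  assumes "integrable lborel f" "integrable lborel g"
  shows "integrable lborel (\<lambda>p. f (fst p) * g (snd p))"
    and "(\<integral>p. f (fst p) * g (snd p) \<partial>lborel) = (\<integral>x. f x \<partial>lborel) * (\<integral>y. g y \<partial>lborel)"
proof -
  have [measurable]: "f \<in> borel_measurable borel" "g \<in> borel_measurable borel"
    using assms[THEN borel_measurable_integrable] by simp_all
  have "integrable (lborel \<Otimes>\<^sub>M lborel) (\<lambda>p. f (fst p) * g (snd p))"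
  proof (rule lborel_pair.Fubini_integrable)
    show "(\<lambda>p. f (fst p) * g (snd p)) \<in> borel_measurable (lborel \<Otimes>\<^sub>M lborel)" by measurable
    show "integrable lborel (\<lambda>x. \<integral>y. norm (f (fst (x, y)) * g (snd (x, y))) \<partial>lborel)"
      using assms by (simp add: abs_mult)
  qed (use assms in simp)
  then show *: "integrable lborel (\<lambda>p. f (fst p) * g (snd p))" by (simp add: lborel_prod)
  show "(\<integral>p. f (fst p) * g (snd p) \<partial>lborel) = (\<integral>x. f x \<partial>lborel) * (\<integral>y. g y \<partial>lborel)"
    using lborel_pair.integral_fst'[of "\<lambda>p. f (fst p) * g (snd p)"] *
    by (simp add: lborel_prod)
qed

lemma integral_lborel_pair:
  fixes h :: "'a::euclidean_space \<times> 'b::euclidean_space \<Rightarrow> real"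
  assumes "integrable lborel h"
  shows "(\<integral>p. h p \<partial>lborel) = (\<integral>x. (\<integral>y. h (x, y) \<partial>lborel) \<partial>lborel)"
    and "integrable lborel (\<lambda>x. \<integral>y. h (x, y) \<partial>lborel)"
proof -
  have "integrable (lborel \<Otimes>\<^sub>M lborel) h" using assms by (simp add: lborel_prod)
  from lborel_pair.integral_fst'[OF this] lborel_pair.integrable_fst'[OF this]
  show "(\<integral>p. h p \<partial>lborel) = (\<integral>x. (\<integral>y. h (x, y) \<partial>lborel) \<partial>lborel)"
    and "integrable lborel (\<lambda>x. \<integral>y. h (x, y) \<partial>lborel)"
    by (simp_all add: lborel_prod)
qed

text \<open>The shear $(x, b) \mapsto (x, b + mx)$ preserves area: integrate over the lines of slope $m$ first.\<close>

lemma integral_plane_by_lines: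
  fixes h :: "real \<times> real \<Rightarrow> real"
  assumes "integrable lborel h"
  shows "(\<integral>p. h p \<partial>lborel) = (\<integral>b. (\<integral>x. h (x, b + m * x) \<partial>lborel) \<partial>lborel)"
proof -
  have [measurable]: "h \<in> borel_measurable (borel \<Otimes>\<^sub>M borel)"
    using borel_measurable_integrable[OF assms] by (simp add: borel_prod)
  have int: "integrable (lborel \<Otimes>\<^sub>M lborel) h" using assms by (simp add: lborel_prod)
  have shift: "(\<integral>b. k (b + m * x) \<partial>lborel) = (\<integral>y. k y \<partial>lborel)" for k :: "real \<Rightarrow> real" and x
    using lborel_integral_real_affine[of 1 k "m * x"] by (simp add: add.commute)
  have "integrable (lborel \<Otimes>\<^sub>M lborel) (\<lambda>(x, b). h (x, b + m * x))"
  proof (rule lborel_pair.Fubini_integrable)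
    show "(\<lambda>(x, b). h (x, b + m * x)) \<in> borel_measurable (lborel \<Otimes>\<^sub>M lborel)" by measurable
    show "integrable lborel (\<lambda>x. \<integral>y. norm (case (x, y) of (x, b) \<Rightarrow> h (x, b + m * x)) \<partial>lborel)"
      using lborel_pair.integrable_fst'[OF integrable_norm[OF int]]
        shift[where k="\<lambda>y. \<bar>h (x, y)\<bar>" and x=x for x] by simp
    show "AE x in lborel. integrable lborel (\<lambda>y. case (x, y) of (x, b) \<Rightarrow> h (x, b + m * x))"
      using lborel_pair.AE_integrable_fst'[OF int]
    proof eventually_elim
      case (elim x)
      then show ?case using lborel_integrable_real_affine[of "\<lambda>y. h (x, y)" 1 "m * x"]
        by (simp add: add.commute)
    qed
  qed
  from lborel_pair.Fubini_integral[OF this]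
  have "(\<integral>b. (\<integral>x. h (x, b + m * x) \<partial>lborel) \<partial>lborel) = (\<integral>x. (\<integral>b. h (x, b + m * x) \<partial>lborel) \<partial>lborel)" .
  also have "\<dots> = (\<integral>x. (\<integral>y. h (x, y) \<partial>lborel) \<partial>lborel)" 
    by (subst shift[where k="\<lambda>y. h (x, y)" for x]) (rule refl)
  also have "\<dots> = (\<integral>p. h p \<partial>lborel)"
    using lborel_pair.integral_fst'[OF int] by (simp add: lborel_prod)
  finally show ?thesis by simp
qed

text \<open>A weight that is constant along the lines of slope $m$ only sees the line integrals of $f$.\<close>

lemma ridge_integral_le:
  fixes f :: "real \<times> real \<Rightarrow> real" and g :: "real \<Rightarrow> real"
  assumes int: "integrable lborel (\<lambda>p. f p * g (snd p - m * fst p))"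
    and g: "integrable lborel g"
    and lines: "\<And>b. \<bar>\<integral>x. f (x, b + m * x) \<partial>lborel\<bar> \<le> K"
  shows "\<bar>\<integral>p. f p * g (snd p - m * fst p) \<partial>lborel\<bar> \<le> K * (\<integral>b. \<bar>g b\<bar> \<partial>lborel)"
proof -
  let ?F = "\<lambda>b. \<integral>x. f (x, b + m * x) \<partial>lborel"
  have K: "0 \<le> K" using lines[of 0] by linarith
  have eq: "(\<integral>p. f p * g (snd p - m * fst p) \<partial>lborel) = (\<integral>b. ?F b * g b \<partial>lborel)"
    by (subst integral_plane_by_lines[OF int, of m]) simp
  have "\<bar>\<integral>b. ?F b * g b \<partial>lborel\<bar> \<le> (\<integral>b. \<bar>?F b * g b\<bar> \<partial>lborel)"
    by (rule integral_abs_bound)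
  also have "\<dots> \<le> (\<integral>b. K * \<bar>g b\<bar> \<partial>lborel)"
    by (rule integral_mono') (use g K lines in \<open>auto simp: abs_mult intro!: mult_right_mono\<close>)
  also have "\<dots> = K * (\<integral>b. \<bar>g b\<bar> \<partial>lborel)"
    by (rule integral_mult_right_zero)
  finally show ?thesis using eq by simp
qed

section \<open>Bounded line integrals force a small energy\<close>

locale box_function =
  fixes f :: "real \<times> real \<Rightarrow> real" and N :: real
  assumes measurable_f [measurable]: "f \<in> borel_measurable borel"
    and abs_f_le: "\<And>p. \<bar>f p\<bar> \<le> 1"
    and f_outside: "\<And>p. p \<notin> cbox (0, 0) (N, N) \<Longrightarrow> f p = 0"
    and N_nonneg: "0 \<le> N"
begin

lemma integrable_times_bounded:
  assumes [measurable]: "k \<in> borel_measurable borel" and "\<And>p. \<bar>k p\<bar> \<le> B"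
  shows "integrable lborel (\<lambda>p. f p * k p)"
proof (rule integrable_bounded_on_cbox)
  have "0 \<le> B" using assms(2)[of undefined] by linarith
  show "\<bar>f p * k p\<bar> \<le> B" for p
    using mult_mono[OF abs_f_le[of p] assms(2)[of p]] by (simp add: abs_mult)
  show "f p * k p = 0" if "p \<notin> cbox (0, 0) (N, N)" for p using f_outside[OF that] by simp
qed measurable

lemma integrable_pair_times_bounded:
  fixes k :: "(real \<times> real) \<times> (real \<times> real) \<Rightarrow> real"
  assumes [measurable]: "k \<in> borel_measurable borel" and "\<And>p. \<bar>k p\<bar> \<le> B"
  shows "integrable lborel (\<lambda>P. f (fst P) * f (snd P) * k P)"
proof (rule integrable_bounded_on_cbox)
  have "\<bar>f (fst P)\<bar> * \<bar>f (snd P)\<bar> * \<bar>k P\<bar> \<le> 1 * 1 * B" for P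
    by (intro mult_mono abs_f_le assms(2)) auto
  then show "\<bar>f (fst P) * f (snd P) * k P\<bar> \<le> B" for P
    by (simp add: abs_mult)
  show "f (fst P) * f (snd P) * k P = 0" if "P \<notin> cbox ((0, 0), (0, 0)) ((N, N), (N, N))" for P
    using f_outside[of "fst P"] f_outside[of "snd P"] that by (cases P) auto
qed measurable

text \<open>For a fixed slope the double integral is $\int\!\int F(b)\,F(b')\,\kappa(b - b')$, where $F$ is the
  line integral as a function of the intercept and $\kappa$ the ramp kernel. The bound on $F$ is
  used twice: the inner integral \<open>h\<close> is at most $K \|\kappa\|_1$, and only the intercepts in the
  interval \<open>I\<close>, which contains those of all lines meeting the box, contribute to the outer one.
  The growth of \<open>I\<close> with the slope cancels against the decay of $\|\kappa\|_1$.\<close>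

lemma energy_of_slope_le:
  assumes e: "0 < e"
    and lines: "\<And>b. \<bar>\<integral>x. f (x, b + m * x) \<partial>lborel\<bar> \<le> K"
  shows "\<bar>\<integral>P. f (fst P) * f (snd P) *
            ramp_kernel e m ((snd (fst P) - snd (snd P)) - m * (fst (fst P) - fst (snd P))) \<partial>lborel\<bar>
         \<le> 2 * pi * N * K\<^sup>2 / e"
proof -
  let ?k = "ramp_kernel e m"
  define V where "V = (\<integral>t. \<bar>?k t\<bar> \<partial>lborel)"
  define h where "h t = (\<integral>q. f q * ?k (t - (snd q - m * fst q)) \<partial>lborel)" for t
  define I where "I = {- (N * \<bar>m\<bar>) .. N + N * \<bar>m\<bar>}"
  have K: "0 \<le> K" using lines[of 0] by linarith
  have V0: "0 \<le> V" by (simp add: V_def)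
  have [measurable]: "?k \<in> borel_measurable borel"
    using borel_measurable_integrable[OF integrable_ramp_kernel(1)[OF e]] by simp
  have kb: "\<bar>?k t\<bar> \<le> 1 / e\<^sup>2" for t
  proof -
    have "1 / e\<^sup>2 * (1 / (1 + \<bar>m\<bar>)\<^sup>2) \<le> 1 / e\<^sup>2 * 1"
      using e by (intro mult_left_mono) (auto simp: field_simps)
    then show ?thesis using abs_ramp_kernel_le_inverse_square[OF e, of m t] by linarith
  qed
  have hb: "\<bar>h t\<bar> \<le> K * V" for t
  proof -
    have "(\<integral>s. \<bar>?k (t - s)\<bar> \<partial>lborel) = V"
      unfolding V_def using lborel_integral_real_affine[of "-1" "\<lambda>s. \<bar>?k s\<bar>" t] by simp
    moreover have "integrable lborel (\<lambda>s. ?k (t - s))"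
      using lborel_integrable_real_affine[OF integrable_ramp_kernel(1)[OF e], of "-1" m t] by simp
    moreover have "integrable lborel (\<lambda>q. f q * ?k (t - (snd q - m * fst q)))"
      by (rule integrable_times_bounded[OF _ kb]) measurable
    ultimately show ?thesis
      unfolding h_def using ridge_integral_le[of f "\<lambda>s. ?k (t - s)" m K] lines by simp
  qed
  have [measurable]: "h \<in> borel_measurable borel"
  proof -
    have "(\<lambda>t. \<integral>q. (case (t, q) of (t, q) \<Rightarrow> f q * ?k (t - (snd q - m * fst q))) \<partial>lborel) \<in> borel_measurable borel"
      by (rule lborel.borel_measurable_lebesgue_integral)
         (simp, measurable)
    then show ?thesis by (simp add: h_def[abs_def])
  qed
  have int: "integrable lborel (\<lambda>P. f (fst P) * f (snd P) *
            ?k ((snd (fst P) - snd (snd P)) - m * (fst (fst P) - fst (snd P))))"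
    by (rule integrable_pair_times_bounded[OF _ kb]) measurable
  have "(\<integral>P. f (fst P) * f (snd P) *
            ?k ((snd (fst P) - snd (snd P)) - m * (fst (fst P) - fst (snd P))) \<partial>lborel)
      = (\<integral>p. (\<integral>q. f p * f q * ?k ((snd p - snd q) - m * (fst p - fst q)) \<partial>lborel) \<partial>lborel)"
    by (subst integral_lborel_pair(1)[OF int]) simp
  also have "\<dots> = (\<integral>p. f p * (h (snd p - m * fst p) * indicator I (snd p - m * fst p)) \<partial>lborel)"
  proof (intro Bochner_Integration.integral_cong refl)
    fix p :: "real \<times> real"
    have "(\<integral>q. f p * f q * ?k ((snd p - snd q) - m * (fst p - fst q)) \<partial>lborel)
       = (\<integral>q. f p * (f q * ?k ((snd p - m * fst p) - (snd q - m * fst q))) \<partial>lborel)"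
      by (intro Bochner_Integration.integral_cong refl) (simp add: algebra_simps)
    also have "\<dots> = f p * h (snd p - m * fst p)" by (simp add: h_def)
    also have "\<dots> = f p * (h (snd p - m * fst p) * indicator I (snd p - m * fst p))"
    proof (cases "p \<in> cbox (0, 0) (N, N)")
      case True
      then have xy: "0 \<le> fst p" "fst p \<le> N" "0 \<le> snd p" "snd p \<le> N" by (cases p; auto)+
      have "\<bar>m * fst p\<bar> \<le> N * \<bar>m\<bar>"
        using mult_right_mono[OF xy(2) abs_ge_zero[of m]] xy(1) by (simp add: abs_mult mult.commute)
      then have "snd p - m * fst p \<in> I" using xy unfolding I_def by (auto simp: abs_le_iff)
      then show ?thesis by simp
    qed (simp add: f_outside)
    finally show "(\<integral>q. f p * f q * ?k ((snd p - snd q) - m * (fst p - fst q)) \<partial>lborel)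
        = f p * (h (snd p - m * fst p) * indicator I (snd p - m * fst p))" .
  qed
  finally have eq: "(\<integral>P. f (fst P) * f (snd P) *
            ?k ((snd (fst P) - snd (snd P)) - m * (fst (fst P) - fst (snd P))) \<partial>lborel)
      = (\<integral>p. f p * (h (snd p - m * fst p) * indicator I (snd p - m * fst p)) \<partial>lborel)" .
  have hI: "\<bar>h t * indicator I t\<bar> \<le> K * V * indicator I t" for t
    using hb[of t] by (auto simp: indicator_def)
  have hI': "\<bar>h t * indicator I t\<bar> \<le> K * V" for t
    using hb[of t] K V0 by (auto simp: indicator_def)
  have iI: "integrable lborel (\<lambda>t. K * V * indicator I t)"
    unfolding I_def by (intro integrable_mult_right integrable_real_indicator) (auto simp: emeasure_lborel_Icc_eq)
  have ihI: "integrable lborel (\<lambda>t. h t * indicator I t)"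
    by (rule Bochner_Integration.integrable_bound[OF iI])
       (use hI order_trans[OF _ abs_ge_self] in \<open>auto simp: I_def\<close>)
  have ridge: "\<bar>\<integral>p. f p * (h (snd p - m * fst p) * indicator I (snd p - m * fst p)) \<partial>lborel\<bar>
      \<le> K * (\<integral>t. \<bar>h t * indicator I t\<bar> \<partial>lborel)"
    by (rule ridge_integral_le[OF _ ihI lines], rule integrable_times_bounded[OF _ hI'])
       (unfold I_def, measurable)
  have "(\<integral>t. \<bar>h t * indicator I t\<bar> \<partial>lborel) \<le> (\<integral>t. K * V * indicator I t \<partial>lborel)"
    by (rule integral_mono[OF integrable_abs[OF ihI] iI hI])
  also have "\<dots> = K * V * (N * (1 + 2 * \<bar>m\<bar>))"
    using N_nonneg by (simp add: I_def algebra_simps)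
  also have "\<dots> \<le> K * (pi / (e * (1 + \<bar>m\<bar>))) * (N * (2 * (1 + \<bar>m\<bar>)))"
    using integrable_ramp_kernel(2)[OF e, of m] K V0 N_nonneg e
    by (intro mult_mono mult_left_mono) (auto simp: V_def intro!: mult_nonneg_nonneg divide_nonneg_nonneg)
  also have "\<dots> = 2 * pi * N * K / e"
    using e by (simp add: divide_simps add_pos_nonneg)
  finally have "(\<integral>t. \<bar>h t * indicator I t\<bar> \<partial>lborel) \<le> 2 * pi * N * K / e" .
  from order_trans[OF ridge mult_left_mono[OF this K]] show ?thesis
    unfolding eq by (simp add: power2_eq_square mult_ac)
qed

text \<open>Licenses the exchange of the slope integral with the integral over pairs of points.\<close>

lemma integrable_slopes_times_pairs:
  assumes e: "0 < e"
  shows "integrable (lborel \<Otimes>\<^sub>M lborel) (\<lambda>(m, P). f (fst P) * f (snd P) *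
           ramp_kernel e m ((snd (fst P) - snd (snd P)) - m * (fst (fst P) - fst (snd P))))"
proof (rule Bochner_Integration.integrable_bound)
  let ?B = "cbox ((0, 0), (0, 0)) ((N, N), (N, N)) :: ((real \<times> real) \<times> (real \<times> real)) set"
  let ?h = "\<lambda>p. (1 / e\<^sup>2 * (1 / (1 + \<bar>fst p\<bar>)\<^sup>2)) * indicator ?B (snd p)"
  have "integrable lborel (\<lambda>m::real. 1 / e\<^sup>2 * (1 / (1 + \<bar>m\<bar>)\<^sup>2))"
    using integrable.intros[OF has_bochner_integral_inverse_square] by (rule integrable_mult_right)
  moreover have "integrable lborel (indicator ?B :: _ \<Rightarrow> real)"
    by (intro integrable_real_indicator) (auto simp: emeasure_lborel_cbox_eq)
  ultimately show "integrable (lborel \<Otimes>\<^sub>M lborel) ?h"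
    unfolding lborel_prod by (rule integrable_tensor(1))
  show "AE p in lborel \<Otimes>\<^sub>M lborel. norm (case p of (m, P) \<Rightarrow> f (fst P) * f (snd P) *
           ramp_kernel e m ((snd (fst P) - snd (snd P)) - m * (fst (fst P) - fst (snd P)))) \<le> norm (?h p)"
  proof (rule AE_I2, clarify)
    fix m and x y x' y' :: real
    show "norm (f (fst ((x, y), x', y')) * f (snd ((x, y), x', y')) * ramp_kernel e m
       (snd (fst ((x, y), x', y')) - snd (snd ((x, y), x', y')) - m * (fst (fst ((x, y), x', y')) - fst (snd ((x, y), x', y')))))
      \<le> norm (?h (m, (x, y), x', y'))"
    proof (cases "((x, y), x', y') \<in> ?B")
      case True
      have "\<bar>f (x, y)\<bar> * \<bar>f (x', y')\<bar> * \<bar>ramp_kernel e m (y - y' - m * (x - x'))\<bar>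
          \<le> 1 * 1 * (1 / e\<^sup>2 * (1 / (1 + \<bar>m\<bar>)\<^sup>2))"
        by (intro mult_mono abs_f_le abs_ramp_kernel_le_inverse_square e) auto
      then show ?thesis using True by (simp add: abs_mult)
    next
      case False
      then have z: "f (x, y) * f (x', y') = 0"
        using f_outside[of "(x, y)"] f_outside[of "(x', y')"] by auto
      show ?thesis by (simp only: fst_conv snd_conv z mult_zero_left norm_zero norm_ge_zero)
    qed
  qed
qed measurable

text \<open>The integral over all slopes of the double integrals above, with the slope already integrated
  out; it is nearly $2\pi^2 \|f\|_2^2$ when $e$ is small against the scale on which $f$ varies.\<close>

definition energy :: "real \<Rightarrow> real" where
  "energy e = (\<integral>P. f (fst P) * f (snd P) *
     (2 * cauchy_kernel e (fst (fst P) - fst (snd P)) * cauchy_kernel e (snd (fst P) - snd (snd P))) \<partial>lborel)"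

text \<open>The factor $\sqrt{1 + m^2}$ is the arc length per unit of $x$. It gives $K^2 = M^2/(1 + m^2)$ for
  slope $m$, and this decay makes the slope integral converge.\<close>

lemma energy_le:
  assumes e: "0 < e"
    and lines: "\<And>m b. sqrt (1 + m\<^sup>2) * \<bar>\<integral>x. f (x, b + m * x) \<partial>lborel\<bar> \<le> M"
  shows "energy e \<le> 8 * pi * N * M\<^sup>2 / e"
proof -
  define J where "J m = (\<integral>P. f (fst P) * f (snd P) *
            ramp_kernel e m ((snd (fst P) - snd (snd P)) - m * (fst (fst P) - fst (snd P))) \<partial>lborel)" for m
  note int = integrable_slopes_times_pairs[OF e]
  have J: "energy e = (\<integral>m. J m \<partial>lborel)"
    unfolding energy_def J_def lborel_pair.Fubini_integral[OF int, symmetric]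
    by (simp add: integral_ramp_kernel_slope[OF e])
  have iJ: "integrable lborel J"
    using lborel_pair.integrable_fst[OF int] unfolding J_def .
  have bJ: "J m \<le> 4 * pi * N * M\<^sup>2 / e * (1 / (1 + \<bar>m\<bar>)\<^sup>2)" for m
  proof -
    have r: "0 < sqrt (1 + m\<^sup>2)" by (simp add: add_pos_nonneg)
    have "\<bar>\<integral>x. f (x, b + m * x) \<partial>lborel\<bar> \<le> M / sqrt (1 + m\<^sup>2)" for b
      using lines[of m b] r by (simp add: field_simps)
    from energy_of_slope_le[OF e this]
    have "J m \<le> 2 * pi * N * (M / sqrt (1 + m\<^sup>2))\<^sup>2 / e" unfolding J_def by linarith
    also have "\<dots> = 2 * pi * N / e * (M\<^sup>2 * (1 / (1 + m\<^sup>2)))"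
      by (simp add: power_divide)
    also have "\<dots> \<le> 2 * pi * N / e * (M\<^sup>2 * (2 * (1 / (1 + \<bar>m\<bar>)\<^sup>2)))"
    proof (intro mult_left_mono)
      \<comment> \<open>Compare $1 + m^2$ with $(1 + |m|)^2$, whose reciprocal has the integral 2.\<close>
      have "0 \<le> (\<bar>m\<bar> - 1)\<^sup>2" by simp
      then have "(1 + \<bar>m\<bar>)\<^sup>2 \<le> 2 * (1 + m\<^sup>2)" by (simp add: power2_eq_square algebra_simps)
      then show "1 / (1 + m\<^sup>2) \<le> 2 * (1 / (1 + \<bar>m\<bar>)\<^sup>2)"
        by (simp add: divide_simps add_pos_nonneg)
    qed (use e N_nonneg in auto)
    finally show ?thesis by simp
  qed
  have "(\<integral>m. J m \<partial>lborel) \<le> (\<integral>m. 4 * pi * N * M\<^sup>2 / e * (1 / (1 + \<bar>m\<bar>)\<^sup>2) \<partial>lborel)"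
    using iJ integrable.intros[OF has_bochner_integral_inverse_square]
    by (intro integral_mono bJ integrable_mult_right)
  also have "\<dots> = 8 * pi * N * M\<^sup>2 / e"
    by (simp only: integral_mult_right_zero has_bochner_integral_integral_eq[OF has_bochner_integral_inverse_square])
  finally show ?thesis using J by simp
qed

end

section \<open>A checkerboard function has large energy\<close>

lemma integral_cauchy_shift:
  assumes "0 < e"
  shows "integrable lborel (\<lambda>t. cauchy_kernel e (x - t))" "(\<integral>t. cauchy_kernel e (x - t) \<partial>lborel) = pi"
  using lborel_integrable_real_affine[OF integrable.intros[OF has_bochner_integral_cauchy[OF assms]], of "-1" x]
    lborel_integral_real_affine[of "-1" "cauchy_kernel e" x]
    has_bochner_integral_integral_eq[OF has_bochner_integral_cauchy[OF assms]] by simp_all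

lemma integral_cauchy_near:
  fixes d e x :: real
  assumes "0 < e" "0 \<le> d"
  shows "integrable lborel (\<lambda>t. indicator {x - d .. x + d} t * cauchy_kernel e (x - t))"
    and "(\<integral>t. indicator {x - d .. x + d} t * cauchy_kernel e (x - t) \<partial>lborel) = 2 * arctan (d / e)"
proof -
  show "integrable lborel (\<lambda>t. indicator {x - d .. x + d} t * cauchy_kernel e (x - t))"
    using integrable_mult_indicator[OF _ integral_cauchy_shift(1)[OF assms(1), of x], of "{x - d .. x + d}"] by simp
  have "(\<integral>t. indicator {x - d .. x + d} t *\<^sub>R cauchy_kernel e (x - t) \<partial>lborel)
      = - arctan ((x - (x + d)) / e) - (- arctan ((x - (x - d)) / e))"
  proof (rule integral_FTC_atLeastAtMost)
    show "((\<lambda>t. - arctan ((x - t) / e)) has_vector_derivative cauchy_kernel e (x - t)) (at t within {x - d..x + d})" for t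
      unfolding has_real_derivative_iff_has_vector_derivative[symmetric] cauchy_kernel_def using assms
      by (auto intro!: derivative_eq_intros simp: field_simps power2_eq_square)
    show "continuous_on {x - d..x + d} (\<lambda>t. cauchy_kernel e (x - t))"
      unfolding cauchy_kernel_def using assms
      by (intro continuous_intros) (auto simp: add_nonneg_eq_0_iff)
  qed (use assms in simp)
  then show "(\<integral>t. indicator {x - d .. x + d} t * cauchy_kernel e (x - t) \<partial>lborel) = 2 * arctan (d / e)"
    by (simp add: arctan_minus)
qed

text \<open>Coordinates at distance at least \<open>d\<close> from the cell borders. The right end point is left out so
  that a \<open>d\<close>-neighbour cannot reach the next cell.\<close>

definition deep :: "nat \<Rightarrow> real \<Rightarrow> real set" where
  "deep n d = (\<Union>i<n. {real i + d ..< real i + 1 - d})"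

lemma deep_measurable [measurable]: "deep n d \<in> sets borel"
  unfolding deep_def by measurable

lemma deep_near:
  assumes "x \<in> deep n d" "0 \<le> d" "t \<in> {x - d .. x + d}"
  shows "\<lfloor>t\<rfloor> = \<lfloor>x\<rfloor>" "0 \<le> t" "t \<le> real n"
proof -
  obtain i where i: "i < n" "real i + d \<le> x" "x < real i + 1 - d"
    using assms(1) by (auto simp: deep_def)
  have "\<lfloor>t\<rfloor> = int i" "\<lfloor>x\<rfloor> = int i" using i assms by (auto intro!: floor_unique)
  then show "\<lfloor>t\<rfloor> = \<lfloor>x\<rfloor>" by simp
  show "0 \<le> t" using i assms by simp
  have "real i + 1 \<le> real n" using i(1) by linarith
  then show "t \<le> real n" using i assms by simp
qed

lemma measure_deep:
  assumes "0 \<le> d" "d \<le> 1 / 2"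
  shows "integrable lborel (indicator (deep n d) :: real \<Rightarrow> real)"
    and "(\<integral>x. indicator (deep n d) x \<partial>lborel) = n * (1 - 2 * d)"
proof -
  have disj: "disjoint_family_on (\<lambda>i. {real i + d ..< real i + 1 - d}) {..<n}"
  unfolding disjoint_family_on_def
  proof (intro ballI impI)
    fix i j :: nat assume "i \<noteq> j"
    then have "real i + 1 \<le> real j \<or> real j + 1 \<le> real i" by linarith
    then show "{real i + d ..< real i + 1 - d} \<inter> {real j + d ..< real j + 1 - d} = {}"
      using assms by auto
  qed
  have fin: "emeasure lborel {real i + d ..< real i + 1 - d} \<noteq> \<infinity>" for i
    using assms by (simp add: emeasure_lborel_Ico)
  have "measure lborel (deep n d) = (\<Sum>i<n. measure lborel {real i + d ..< real i + 1 - d})"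
    unfolding deep_def by (rule measure_finite_Union[OF _ _ disj]) (use fin in auto)
  also have "\<dots> = n * (1 - 2 * d)" using assms by simp
  finally show "(\<integral>x. indicator (deep n d) x \<partial>lborel) = n * (1 - 2 * d)" by simp
  have "emeasure lborel (deep n d) \<le> emeasure lborel {0 .. real n}"
  proof (intro emeasure_mono subsetI)
    fix x assume x: "x \<in> deep n d"
    show "x \<in> {0 .. real n}"
      using deep_near(2,3)[OF x assms(1), of x] assms(1) by simp
  qed simp
  then have "emeasure lborel (deep n d) < \<infinity>"
    by (simp add: emeasure_lborel_Icc_eq le_less_trans)
  then show "integrable lborel (indicator (deep n d) :: real \<Rightarrow> real)"
    by (intro integrable_real_indicator) auto
qed

locale checkerboard = box_function f "real n" for f :: "real \<times> real \<Rightarrow> real" and n :: nat +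
  assumes cells: "\<And>p q. \<lbrakk>p \<in> cbox (0, 0) (real n, real n); q \<in> cbox (0, 0) (real n, real n);
      \<lfloor>fst p\<rfloor> = \<lfloor>fst q\<rfloor>; \<lfloor>snd p\<rfloor> = \<lfloor>snd q\<rfloor>\<rbrakk> \<Longrightarrow> f p * f q = 1"
begin

text \<open>The kernel is positive with mass $2\pi^2$ and $|f(p) f(q)| \le 1$, so every point $p$ of the box
  contributes at least $-2\pi^2$. If both coordinates of $p$ are deep, then $f(p) f(q) = 1$ on the
  square of half side $d$ around $p$; this turns the sign of that part of the mass, which is
  $2\,(2 \arctan(d/e))^2$, and gains twice as much.\<close>

lemma energy_ge:
  fixes d e :: real
  assumes e: "0 < e" and d: "0 \<le> d" "d \<le> 1 / 2"
  shows "4 * (2 * arctan (d / e))\<^sup>2 * (n * (1 - 2 * d))\<^sup>2 - 2 * pi\<^sup>2 * n\<^sup>2 \<le> energy e"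
proof -
  let ?Box = "cbox (0, 0) (real n, real n) :: (real \<times> real) set"
  define a where "a = 2 * arctan (d / e)"
  define \<Phi> where "\<Phi> p q = 2 * cauchy_kernel e (fst p - fst q) * cauchy_kernel e (snd p - snd q)" for p q :: "real \<times> real"
  define A where "A p = (\<integral>q. f p * f q * \<Phi> p q \<partial>lborel)" for p
  define near where "near p q = indicator {fst p - d .. fst p + d} (fst q) * (indicator {snd p - d .. snd p + d} (snd q) :: real)"
    for p q :: "real \<times> real"
  have c0: "0 \<le> cauchy_kernel e u" for u using e by (simp add: cauchy_kernel_def)
  have c1: "cauchy_kernel e u \<le> 1 / e" for u
  proof -
    have "e / (e\<^sup>2 + u\<^sup>2) \<le> e / e\<^sup>2" using e by (intro divide_left_mono) (auto intro!: mult_pos_pos add_pos_nonneg)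
    then show ?thesis using e by (simp add: cauchy_kernel_def power2_eq_square)
  qed
  have \<Phi>0: "0 \<le> \<Phi> p q" for p q by (simp add: \<Phi>_def c0)
  have \<Phi>1: "\<Phi> p q \<le> 2 * (1 / e) * (1 / e)" for p q
    unfolding \<Phi>_def by (intro mult_mono c1 c0) (use e c0 in auto)
  have [measurable]: "(\<lambda>P. \<Phi> (fst P) (snd P)) \<in> borel_measurable borel" "\<Phi> p \<in> borel_measurable borel" for p
    unfolding \<Phi>_def by measurable
  have i\<Phi>: "integrable lborel (\<Phi> p)" "(\<integral>q. \<Phi> p q \<partial>lborel) = 2 * pi\<^sup>2" for p
    using integrable_tensor[of "\<lambda>t. 2 * cauchy_kernel e (fst p - t)" "\<lambda>t. cauchy_kernel e (snd p - t)"]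
      integral_cauchy_shift[OF e] by (simp_all add: \<Phi>_def[abs_def] power2_eq_square)
  have inear: "integrable lborel (\<lambda>q. near p q * \<Phi> p q)" "(\<integral>q. near p q * \<Phi> p q \<partial>lborel) = 2 * a\<^sup>2" for p
  proof -
    have eq: "near p q * \<Phi> p q = 2 * (indicator {fst p - d .. fst p + d} (fst q) * cauchy_kernel e (fst p - fst q)) *
        (indicator {snd p - d .. snd p + d} (snd q) * cauchy_kernel e (snd p - snd q))" for q
      by (simp add: near_def \<Phi>_def)
    show "integrable lborel (\<lambda>q. near p q * \<Phi> p q)" "(\<integral>q. near p q * \<Phi> p q \<partial>lborel) = 2 * a\<^sup>2"
      unfolding eq
      using integrable_tensor[of "\<lambda>t. 2 * (indicator {fst p - d .. fst p + d} t * cauchy_kernel e (fst p - t))"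
          "\<lambda>t. indicator {snd p - d .. snd p + d} t * cauchy_kernel e (snd p - t)"]
        integral_cauchy_near[OF e d(1)] by (simp_all add: a_def power2_eq_square)
  qed
  have iff: "integrable lborel (\<lambda>q. f p * f q * \<Phi> p q)" for p
    using integrable_mult_right[OF integrable_times_bounded[of "\<Phi> p" "2 * (1 / e) * (1 / e)"], of "f p"]
      \<Phi>0 \<Phi>1 by (simp add: mult.assoc)
  have ff: "\<bar>f p * f q\<bar> \<le> 1" for p q
    using mult_mono[OF abs_f_le[of p] abs_f_le[of q]] by (simp add: abs_mult)
  have A_ge: "- (2 * pi\<^sup>2) \<le> A p" for p
  proof -
    have "(\<integral>q. - \<Phi> p q \<partial>lborel) \<le> A p"
      unfolding A_def
    proof (rule integral_mono)
      show "- \<Phi> p q \<le> f p * f q * \<Phi> p q" for q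
        using mult_right_mono[OF _ \<Phi>0[of p q], of "-1" "f p * f q"] ff[of p q] by (auto simp: abs_le_iff)
    qed (use i\<Phi> iff in auto)
    then show ?thesis by (simp add: i\<Phi>)
  qed
  have A_deep: "4 * a\<^sup>2 - 2 * pi\<^sup>2 \<le> A p" if p: "fst p \<in> deep n d" "snd p \<in> deep n d" for p
  proof -
    have "(\<integral>q. 2 * (near p q * \<Phi> p q) - \<Phi> p q \<partial>lborel) \<le> A p"
      unfolding A_def
    proof (rule integral_mono)
      fix q :: "real \<times> real"
      show "2 * (near p q * \<Phi> p q) - \<Phi> p q \<le> f p * f q * \<Phi> p q"
      proof (cases "near p q = 0")
        case True
        then show ?thesis
          using mult_right_mono[OF _ \<Phi>0[of p q], of "-1" "f p * f q"] ff[of p q] by (auto simp: abs_le_iff)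
      next
        case False
        then have q: "fst q \<in> {fst p - d .. fst p + d}" "snd q \<in> {snd p - d .. snd p + d}" and n1: "near p q = 1"
          by (auto simp: near_def indicator_def split: if_splits)
        have pp: "fst p \<in> {fst p - d .. fst p + d}" "snd p \<in> {snd p - d .. snd p + d}" using d by auto
        have "f p * f q = 1"
        proof (rule cells)
          have "p \<in> ?Box" "q \<in> ?Box"
            using deep_near(2,3)[OF p(1) d(1) q(1)] deep_near(2,3)[OF p(2) d(1) q(2)]
              deep_near(2,3)[OF p(1) d(1) pp(1)] deep_near(2,3)[OF p(2) d(1) pp(2)]
            by (cases p; cases q; simp)+
          then show "p \<in> ?Box" "q \<in> ?Box" by -
          show "\<lfloor>fst p\<rfloor> = \<lfloor>fst q\<rfloor>" by (rule deep_near(1)[OF p(1) d(1) q(1), symmetric])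
          show "\<lfloor>snd p\<rfloor> = \<lfloor>snd q\<rfloor>" by (rule deep_near(1)[OF p(2) d(1) q(2), symmetric])
        qed
        then show ?thesis unfolding n1 by simp
      qed
      show "integrable lborel (\<lambda>q. 2 * (near p q * \<Phi> p q) - \<Phi> p q)"
        by (intro Bochner_Integration.integrable_diff integrable_mult_right inear i\<Phi>)
    qed (rule iff)
    also have "(\<integral>q. 2 * (near p q * \<Phi> p q) - \<Phi> p q \<partial>lborel) = 4 * a\<^sup>2 - 2 * pi\<^sup>2"
      by (subst Bochner_Integration.integral_diff[OF integrable_mult_right[OF inear(1)] i\<Phi>(1)])
         (use integral_mult_right_zero[of lborel 2 "\<lambda>q. near p q * \<Phi> p q"] inear(2)[of p] i\<Phi>(2)[of p] in linarith)
    finally show ?thesis .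
  qed
  have lower: "4 * a\<^sup>2 * (indicator (deep n d) (fst p) * indicator (deep n d) (snd p)) - 2 * pi\<^sup>2 * indicator ?Box p \<le> A p" for p
  proof (cases "p \<in> ?Box")
    case True
    then show ?thesis using A_ge[of p] A_deep[of p]
      by (cases "fst p \<in> deep n d"; cases "snd p \<in> deep n d") simp_all
  next
    case False
    have "\<not> (fst p \<in> deep n d \<and> snd p \<in> deep n d)"
    proof
      assume p: "fst p \<in> deep n d \<and> snd p \<in> deep n d"
      then have "p \<in> ?Box"
        using deep_near(2,3)[of "fst p" n d "fst p"] deep_near(2,3)[of "snd p" n d "snd p"] d by (cases p) simp
      then show False using False by simp
    qed
    moreover have "A p = 0" by (simp add: A_def f_outside[OF False])
    ultimately show ?thesis using False
      by (cases "fst p \<in> deep n d"; cases "snd p \<in> deep n d") simp_all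
  qed
  have iffP: "integrable lborel (\<lambda>P. f (fst P) * f (snd P) * \<Phi> (fst P) (snd P))"
    by (rule integrable_pair_times_bounded[of _ "2 * (1 / e) * (1 / e)"]) (use \<Phi>0 \<Phi>1 in auto)
  have iA: "integrable lborel A"
    using integral_lborel_pair(2)[OF iffP] by (simp add: A_def[abs_def])
  have E: "energy e = (\<integral>p. A p \<partial>lborel)"
    using integral_lborel_pair(1)[OF iffP] by (simp add: A_def energy_def \<Phi>_def)
  note t = integrable_tensor[OF measure_deep(1)[OF d, of n] measure_deep(1)[OF d, of n]]
  have iBox: "integrable lborel (indicator ?Box :: _ \<Rightarrow> real)"
    by (intro integrable_real_indicator) (auto simp: emeasure_lborel_cbox_eq)
  have mBox: "(\<integral>p. indicator ?Box p \<partial>lborel) = (real n)\<^sup>2"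
    by (simp add: measure_lborel_cbox_eq Basis_prod_def power2_eq_square prod.union_disjoint)
  have "(\<integral>p. 4 * a\<^sup>2 * (indicator (deep n d) (fst p) * indicator (deep n d) (snd p)) - 2 * pi\<^sup>2 * indicator ?Box p \<partial>lborel) \<le> energy e"
    unfolding E by (intro integral_mono Bochner_Integration.integrable_diff integrable_mult_right t iBox iA lower)
  also have "(\<integral>p. 4 * a\<^sup>2 * (indicator (deep n d) (fst p) * indicator (deep n d) (snd p)) - 2 * pi\<^sup>2 * indicator ?Box p \<partial>lborel)
     = 4 * a\<^sup>2 * (n * (1 - 2 * d))\<^sup>2 - 2 * pi\<^sup>2 * n\<^sup>2"
    using t iBox measure_deep(2)[OF d, of n] mBox
    by (subst Bochner_Integration.integral_diff) (auto simp: power2_eq_square)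
  finally show ?thesis by (simp add: a_def)
qed

end

section \<open>Colourings and segments\<close>

definition sign_of :: "(int \<Rightarrow> int \<Rightarrow> colour) \<Rightarrow> real \<times> real \<Rightarrow> real" where
  "sign_of f p = (if f \<lfloor>fst p\<rfloor> \<lfloor>snd p\<rfloor> = Black then 1 else - 1)"

lemma coloured_region_iff: "p \<in> coloured_region f c \<longleftrightarrow> f \<lfloor>fst p\<rfloor> \<lfloor>snd p\<rfloor> = c"
proof -
  have "p \<in> cell i j \<longleftrightarrow> \<lfloor>fst p\<rfloor> = i \<and> \<lfloor>snd p\<rfloor> = j" for i j
    by (cases p) (auto simp: cell_def floor_eq_iff)
  then show ?thesis by (auto simp: coloured_region_def)
qed

lemma coloured_region_measurable [measurable]: "coloured_region f c \<in> sets borel"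
proof -
  have "coloured_region f c = (\<Union>i. \<Union>j. if f i j = c then cell i j else {})"
    by (auto simp: coloured_region_def split: if_splits)
  moreover have "cell i j \<in> sets borel" for i j
    unfolding cell_def borel_prod[symmetric] by (intro pair_measureI) auto
  ultimately show ?thesis by (auto intro!: sets.countable_UN)
qed

lemma sign_of_eq: "sign_of f p = indicator (coloured_region f Black) p - indicator (coloured_region f White) p"
  by (cases "f \<lfloor>fst p\<rfloor> \<lfloor>snd p\<rfloor>") (auto simp: sign_of_def coloured_region_iff)

lemma sign_of_measurable [measurable]: "sign_of f \<in> borel_measurable borel"
  unfolding sign_of_eq[abs_def] by measurable

lemma abs_sign_of: "\<bar>sign_of f p\<bar> = 1"
  by (simp add: sign_of_def)

lemma black_minus_white:
  "black_length f a b - white_length f a b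
     = (\<integral>s. indicator {0..dist a b} s * sign_of f (a + s *\<^sub>R sgn (b - a)) \<partial>lborel)"
proof -
  let ?S = "\<lambda>c. {s \<in> {0..dist a b}. a + s *\<^sub>R sgn (b - a) \<in> coloured_region f c}"
  have S: "?S c \<in> sets borel" for c
  proof -
    have [measurable]: "(\<lambda>s. a + s *\<^sub>R sgn (b - a)) \<in> borel_measurable borel"
      by (intro borel_measurable_continuous_onI continuous_intros)
    show ?thesis by measurable
  qed
  have len: "segment_length_in a b (coloured_region f c) = (\<integral>s. indicator (?S c) s \<partial>lborel)" for c
    unfolding segment_length_in_def using S[of c] by (simp add: measure_completion)
  have int: "integrable lborel (indicator (?S c) :: real \<Rightarrow> real)" for c
  proof (rule integrable_real_indicator)
    have "emeasure lborel (?S c) \<le> emeasure lborel {0..dist a b}" by (intro emeasure_mono) auto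
    then show "emeasure lborel (?S c) < \<infinity>" by (simp add: emeasure_lborel_Icc_eq le_less_trans)
  qed (use S in simp)
  have "black_length f a b - white_length f a b = (\<integral>s. indicator (?S Black) s - indicator (?S White) s \<partial>lborel)"
    unfolding black_length_def white_length_def len by (rule Bochner_Integration.integral_diff[OF int int, symmetric])
  also have "\<dots> = (\<integral>s. indicator {0..dist a b} s * sign_of f (a + s *\<^sub>R sgn (b - a)) \<partial>lborel)"
    by (intro Bochner_Integration.integral_cong refl) (auto simp: sign_of_eq indicator_def)
  finally show ?thesis .
qed

lemma abs_black_minus_white_le: "\<bar>black_length f a b - white_length f a b\<bar> \<le> dist a b"
proof -
  have "\<bar>black_length f a b - white_length f a b\<bar>
      \<le> (\<integral>s. \<bar>indicator {0..dist a b} s * sign_of f (a + s *\<^sub>R sgn (b - a))\<bar> \<partial>lborel)"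
    unfolding black_minus_white by (rule integral_abs_bound)
  also have "\<dots> = (\<integral>s. indicator {0..dist a b} s \<partial>lborel)"
    by (simp add: abs_mult abs_sign_of)
  finally show ?thesis by simp
qed

text \<open>A line meets the box in a segment with end points in the box, because the box is compact and
  convex. When the intersection is empty or a single point, the line integral vanishes and a
  degenerate segment serves.\<close>

lemma segment_of_line_in_box:
  assumes N: "0 \<le> N"
  obtains p q where "p \<in> cbox (0, 0) (N, N)" "q \<in> cbox (0, 0) (N, N)"
    "black_length f p q - white_length f p q
      = sqrt (1 + m\<^sup>2) * (\<integral>x. indicator (cbox (0, 0) (N, N)) (x, b + m * x) * sign_of f (x, b + m * x) \<partial>lborel)"
proof -
  let ?Box = "cbox (0, 0) (N, N) :: (real \<times> real) set"
  \<comment> \<open>The abscissae at which the line is in the box form a compact interval.\<close>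
  define X where "X = {x. (x, b + m * x) \<in> ?Box}"
  have X: "X = {0..N} \<inter> (\<lambda>x. b + m * x) -` {0..N}" by (auto simp: X_def)
  have "is_interval X"
    unfolding is_interval_1
  proof (intro ballI allI impI)
    fix u v x assume uv: "u \<in> X" "v \<in> X" and x: "u \<le> x \<and> x \<le> v"
    have "m * u \<le> m * x \<and> m * x \<le> m * v \<or> m * v \<le> m * x \<and> m * x \<le> m * u"
      using x by (cases "0 \<le> m") (auto intro: mult_left_mono mult_left_mono_neg)
    then show "x \<in> X" using uv x by (auto simp: X)
  qed
  moreover have "compact X"
    unfolding X by (intro compact_Int_closed compact_Icc continuous_closed_vimage) auto
  ultimately obtain x0 x1 where I: "X = {x0..x1}"
    using connected_compact_interval_1 is_interval_connected by metis
  define G where "G = (\<integral>x. indicator ?Box (x, b + m * x) * sign_of f (x, b + m * x) \<partial>lborel)"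
  have G: "G = (\<integral>x. indicator {x0..x1} x * sign_of f (x, b + m * x) \<partial>lborel)"
    unfolding G_def I[symmetric] by (intro Bochner_Integration.integral_cong refl) (simp add: X_def indicator_def)
  show thesis
  proof (cases "x0 < x1")
    case True
    define p where "p = (x0, b + m * x0)"
    define q where "q = (x1, b + m * x1)"
    define r where "r = sqrt (1 + m\<^sup>2)"
    have r: "r > 0" by (simp add: r_def add_pos_nonneg)
    have "x0 \<in> X" "x1 \<in> X" using True by (auto simp: I)
    then have pq: "p \<in> ?Box" "q \<in> ?Box" by (auto simp: X_def p_def q_def)
    have qp: "q - p = (x1 - x0) *\<^sub>R (1, m)" by (simp add: p_def q_def algebra_simps)
    have nr: "norm (1::real, m) = r" by (simp add: norm_Pair r_def)
    have "dist p q = norm (q - p)" by (simp add: dist_norm norm_minus_commute)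
    then have d: "dist p q = r * (x1 - x0)"
      unfolding qp norm_scaleR nr using True by simp
    have u: "sgn (q - p) = (1 / r) *\<^sub>R (1, m)"
      unfolding sgn_div_norm qp norm_scaleR nr using True r by (simp add: field_simps)
    \<comment> \<open>Arc length is \<open>r\<close> times the distance travelled in $x$, which gives the substitution $s = r (x - x_0)$.\<close>
    have "black_length f p q - white_length f p q
        = (\<integral>s. indicator {0..dist p q} s * sign_of f (p + s *\<^sub>R sgn (q - p)) \<partial>lborel)"
      by (rule black_minus_white)
    also have "\<dots> = r * (\<integral>x. indicator {0..dist p q} (- r * x0 + r * x) *
        sign_of f (p + (- r * x0 + r * x) *\<^sub>R sgn (q - p)) \<partial>lborel)"
      using r by (subst lborel_integral_real_affine[of r _ "- r * x0"]) auto
    also have "\<dots> = r * G"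
      unfolding G
    proof (intro arg_cong[where f="(*) r"] Bochner_Integration.integral_cong refl)
      fix x
      have "- r * x0 + r * x = r * (x - x0)" by (simp add: algebra_simps)
      then have "p + (- r * x0 + r * x) *\<^sub>R sgn (q - p) = (x, b + m * x)"
        unfolding u using r by (simp add: p_def algebra_simps)
      moreover have "- r * x0 + r * x \<in> {0..dist p q} \<longleftrightarrow> x \<in> {x0..x1}"
        unfolding d \<open>- r * x0 + r * x = r * (x - x0)\<close> using r by (auto simp: zero_le_mult_iff)
      ultimately show "indicator {0..dist p q} (- r * x0 + r * x) * sign_of f (p + (- r * x0 + r * x) *\<^sub>R sgn (q - p))
          = indicator {x0..x1} x * sign_of f (x, b + m * x)"
        by (simp add: indicator_def)
    qed
    finally show thesis using that[OF pq] by (simp add: r_def G_def)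
  next
    case False
    have "G = (\<integral>x. 0 \<partial>(lborel :: real measure))"
      unfolding G
    proof (rule integral_cong_AE)
      show "AE x in lborel. indicator {x0..x1} x * sign_of f (x, b + m * x) = 0"
        using AE_lborel_singleton[of x0] by eventually_elim (use False in \<open>auto simp: indicator_def\<close>)
      show "(\<lambda>x. indicator {x0..x1} x * sign_of f (x, b + m * x)) \<in> borel_measurable lborel"
      proof -
        have [measurable]: "(\<lambda>x. (x, b + m * x)) \<in> borel_measurable borel"
          by (intro borel_measurable_continuous_onI continuous_intros)
        show ?thesis by measurable
      qed
    qed simp
    moreover have "black_length f (0, 0) (0, 0) = white_length f (0, 0) (0, 0)"
      using abs_black_minus_white_le[of f "(0, 0)" "(0, 0)"] by simp
    moreover have "(0, 0) \<in> ?Box" using N by simp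
    ultimately show thesis using that[of "(0, 0)" "(0, 0)"] by (simp add: G_def)
  qed
qed

lemma checkerboard_sign_of:
  "checkerboard (\<lambda>p. indicator (cbox (0, 0) (real n, real n)) p * sign_of f p) n"
proof unfold_locales
  let ?Box = "cbox (0, 0) (real n, real n) :: (real \<times> real) set"
  show "(\<lambda>p. indicator ?Box p * sign_of f p) \<in> borel_measurable borel"
    by (intro borel_measurable_times borel_measurable_indicator sign_of_measurable) auto
  show "\<bar>indicator ?Box p * sign_of f p\<bar> \<le> 1" for p
    by (simp add: abs_mult abs_sign_of indicator_def)
  show "indicator ?Box p * sign_of f p * (indicator ?Box q * sign_of f q) = 1"
    if "p \<in> ?Box" "q \<in> ?Box" "\<lfloor>fst p\<rfloor> = \<lfloor>fst q\<rfloor>" "\<lfloor>snd p\<rfloor> = \<lfloor>snd q\<rfloor>" for p q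
    using that by (simp add: sign_of_def)
qed auto

section \<open>The discrepancy bound\<close>

lemma arctan_ge:
  assumes "0 < (x::real)"
  shows "pi / 2 - 1 / x \<le> arctan x"
proof -
  have "arctan (1 / x) \<le> 1 / x" using arctan_le_self[of "1 / x"] assms by simp
  moreover have "arctan (1 / x) = pi / 2 - arctan x"
    using arctan_inverse[of x] assms by (simp add: sgn_if inverse_eq_divide)
  ultimately show ?thesis by linarith
qed

text \<open>For the scales $e = 1/400$ and $d = 1/20$ the deep points fill the fraction $0.81$ of the box,
  and $0.81 \cdot 4\,(2 \arctan 20)^2 > 29$ outweighs $2\pi^2 < 20$. Hence the energy is at least
  $n^2$, while bounded line integrals would make it $O(n M^2)$.\<close>

lemma box_side_le_line_bound:
  assumes n: "0 < n"
    and lines: "\<And>m b. sqrt (1 + m\<^sup>2) * \<bar>\<integral>x. indicator (cbox (0, 0) (real n, real n)) (x, b + m * x) *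
         sign_of f (x, b + m * x) \<partial>lborel\<bar> \<le> M"
  shows "n \<le> 12800 * M\<^sup>2"
proof -
  interpret checkerboard "\<lambda>p. indicator (cbox (0, 0) (real n, real n)) p * sign_of f p" n
    by (rule checkerboard_sign_of)
  have "4 * (2 * arctan ((1/20) / (1/400)))\<^sup>2 * (real n * (1 - 2 * (1/20)))\<^sup>2 - 2 * pi\<^sup>2 * real (n\<^sup>2)
     \<le> energy (1/400)"
    by (rule energy_ge) auto
  also have "\<dots> \<le> 8 * pi * real n * M\<^sup>2 / (1/400)"
    by (rule energy_le) (use lines in auto)
  finally have E: "4 * (2 * arctan 20)\<^sup>2 * (real n * (9/10))\<^sup>2 - 2 * pi\<^sup>2 * real (n\<^sup>2) \<le> 3200 * pi * real n * M\<^sup>2"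
    by simp
  have at: "3 \<le> 2 * arctan 20" using arctan_ge[of 20] pi_gt3 pi_approx by simp
  have pi4: "pi \<le> 3.15" using pi_approx by simp
  have "9 \<le> (2 * arctan 20)\<^sup>2" using power_mono[OF at, of 2] by simp
  then have "4 * 9 * (real n * (9/10))\<^sup>2 \<le> 4 * (2 * arctan 20)\<^sup>2 * (real n * (9/10))\<^sup>2"
    by (intro mult_right_mono) auto
  moreover have "4 * 9 * (real n * (9/10))\<^sup>2 = (2916/100) * (real n)\<^sup>2"
    by (simp add: power_mult_distrib power_divide)
  moreover have "2 * pi\<^sup>2 * real (n\<^sup>2) \<le> 2 * 10 * (real n)\<^sup>2"
    using power_mono[OF pi4, of 2] by (auto simp: power_divide intro!: mult_right_mono)
  ultimately have "(real n)\<^sup>2 \<le> 3200 * pi * real n * M\<^sup>2"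
    using E zero_le_power2[of "real n"] by linarith
  also have "\<dots> \<le> 3200 * 4 * real n * M\<^sup>2"
    using pi_less_4 by (intro mult_right_mono) auto
  finally have "real n * real n \<le> real n * (12800 * M\<^sup>2)" by (simp add: power2_eq_square mult_ac)
  then show ?thesis using n by simp
qed

theorem theorem1:
  "\<exists>C::real. C > 0 \<and>
     (\<forall>f :: int \<Rightarrow> int \<Rightarrow> colour. \<forall>L::real. L > 0 \<longrightarrow>
        (\<exists>a b :: real \<times> real. dist a b \<ge> L \<and>
           \<bar>black_length f a b - white_length f a b\<bar> \<ge> C * sqrt (dist a b)))"
proof (intro exI[of _ "1/1000"] conjI allI impI)
  fix f :: "int \<Rightarrow> int \<Rightarrow> colour" and L :: real
  assume L: "L > 0"
  show "\<exists>a b :: real \<times> real. dist a b \<ge> L \<and>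
      \<bar>black_length f a b - white_length f a b\<bar> \<ge> 1/1000 * sqrt (dist a b)"
  proof (rule ccontr)
    assume "\<not> ?thesis"
    then have small: "\<bar>black_length f a b - white_length f a b\<bar> < 1/1000 * sqrt (dist a b)"
      if "L \<le> dist a b" for a b :: "real \<times> real" using that by (meson not_le)
    obtain n :: nat where nL: "(500 * L)\<^sup>2 + 1 \<le> real n" using real_arch_simple by blast
    then have "0 < real n" using zero_le_power2[of "500 * L"] by linarith
    then have n: "0 < n" by simp
    \<comment> \<open>This is $\sqrt{4n}/1000$: a segment in the box is shorter than $4n$, so a line integral above
      \<open>M\<close> would contradict the assumed smallness.\<close>
    define M where "M = sqrt n / 500"
    have "500 * L \<le> sqrt n" using nL by (intro real_le_rsqrt) simp
    then have LM: "L \<le> M" by (simp add: M_def)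
    have "sqrt (1 + m\<^sup>2) * \<bar>\<integral>x. indicator (cbox (0, 0) (real n, real n)) (x, b + m * x) *
         sign_of f (x, b + m * x) \<partial>lborel\<bar> \<le> M" for m b
    proof (rule ccontr)
      assume big: "\<not> ?thesis"
      obtain p q where pq: "p \<in> cbox (0, 0) (real n, real n)" "q \<in> cbox (0, 0) (real n, real n)"
        and bw: "black_length f p q - white_length f p q = sqrt (1 + m\<^sup>2) *
          (\<integral>x. indicator (cbox (0, 0) (real n, real n)) (x, b + m * x) * sign_of f (x, b + m * x) \<partial>lborel)"
        by (rule segment_of_line_in_box[OF of_nat_0_le_iff, of n f m b])
      have D: "M < \<bar>black_length f p q - white_length f p q\<bar>"
        using big by (simp add: bw abs_mult)
      then have "L \<le> dist p q" using abs_black_minus_white_le[of f p q] LM by linarith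
      then have "\<bar>black_length f p q - white_length f p q\<bar> < 1/1000 * sqrt (dist p q)" by (rule small)
      also have "dist p q \<le> 2 * n"
      proof -
        have "dist p q \<le> \<bar>fst p - fst q\<bar> + \<bar>snd p - snd q\<bar>"
          using sqrt_sum_squares_le_sum_abs[of "fst p - fst q" "snd p - snd q"]
          by (cases p; cases q) (simp add: dist_Pair_Pair dist_real_def)
        also have "\<bar>fst p - fst q\<bar> \<le> n" using pq by (cases p; cases q) (auto simp: abs_le_iff)
        also have "\<bar>snd p - snd q\<bar> \<le> n" using pq by (cases p; cases q) (auto simp: abs_le_iff)
        finally show ?thesis by simp
      qed
      then have "1/1000 * sqrt (dist p q) \<le> 1/1000 * sqrt (4 * n)" by simp
      also have "\<dots> = M" by (simp add: M_def real_sqrt_mult)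
      finally show False using D by simp
    qed
    from box_side_le_line_bound[OF n this]
    show False using n by (simp add: M_def power_divide)
  qed
qed simp

end
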